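(* For every infinite cardinal $\kappa$ there is a $0$-dimensional $T_2$ topological space $X$ with $|X|=\Delta(X)=\kappa$ such that $X$ is almost $2^{\kappa}$-resolvable (and so extraresolvable) but not $\omega_1$-resolvable. In fact, $X$ can be taken to be a $\kappa$-dense subspace of the Cantor cube $\{0,1\}^{2^{\kappa}}$ of weight $2^{\kappa}$.
   Context: For a topological space $X$, the dispersion character of $X$ is $\Delta(X)=\min\{|G| : G\subset X \text{ open},\ G\neq\emptyset\}$. For a cardinal $\lambda$, the space $X$ is called $\lambda$-resolvable if it contains $\lambda$ many dense subsets that are pairwise disjoint, and almost $\lambda$-resolvable if it contains $\lambda$ many dense subsets such that any two (distinct) of them have nowhere dense intersection in $X$. The space $X$ is called extraresolvable if it is almost $\Delta(X)^+$-resolvable, where $\Delta(X)^+$ is the successor cardinal of $\Delta(X)$. A subset $D$ of a space $Y$ is $\kappa$-dense in $Y$ if $|D\cap U|\ge\kappa$ for every nonempty open set $U\subset Y$. A space is $0$-dimensional if it has a base consisting of clopen sets. The Cantor cube of weight $2^\kappa$ is the product of $2^\kappa$ copies of the two-point discrete space $\{0,1\}$ with the product topology; a subspace of it carries the subspace topology. *)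

theory Defs
  imports "HOL-Analysis.T1_Spaces" "HOL-Analysis.Function_Topology"
begin

unbundle cardinal_syntax

text \<open>
  Cardinals are the cardinal orders of \<open>Main\<close>: a cardinal is a relation \<open>\<kappa>\<close> with
  \<open>Card_order \<kappa>\<close>, the cardinality of a set \<open>A\<close> is \<open>|A|\<close>, and equality and order of cardinals
  are \<open>=o\<close> and \<open>\<le>o\<close>, which also compare cardinals over different types.
\<close>

definition dense_set :: "'a topology \<Rightarrow> 'a set \<Rightarrow> bool" where
  "dense_set X D \<longleftrightarrow> D \<subseteq> topspace X \<and> X closure_of D = topspace X"

definition nowhere_dense_set :: "'a topology \<Rightarrow> 'a set \<Rightarrow> bool" where
  "nowhere_dense_set X A \<longleftrightarrow> A \<subseteq> topspace X \<and> X interior_of (X closure_of A) = {}"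

text \<open>
  The choice below is among open sets of the same (minimal) cardinality, so the value is
  determined up to \<open>=o\<close>. For the empty space there is no nonempty open set and the value is
  unspecified.
\<close>

definition dispersion_character :: "'a topology \<Rightarrow> 'a rel" where
  "dispersion_character X =
     |SOME G. openin X G \<and> G \<noteq> {} \<and> (\<forall>H. openin X H \<and> H \<noteq> {} \<longrightarrow> |G| \<le>o |H| )|"

lemma dispersion_character_is_min:
  assumes "topspace X \<noteq> {}"
  obtains G where "openin X G" "G \<noteq> {}" "dispersion_character X = |G|"
    "\<And>H. openin X H \<Longrightarrow> H \<noteq> {} \<Longrightarrow> |G| \<le>o |H|"
proof -
  let ?P = "\<lambda>G. openin X G \<and> G \<noteq> {} \<and> (\<forall>H. openin X H \<and> H \<noteq> {} \<longrightarrow> |G| \<le>o |H| )"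
  let ?R = "card_of ` {G. openin X G \<and> G \<noteq> {}}"
  have "?R \<noteq> {}"
    using assms by blast
  moreover have "\<forall>r \<in> ?R. Card_order r"
    by (auto simp: card_of_Card_order)
  ultimately have "\<exists>r \<in> ?R. \<forall>r' \<in> ?R. r \<le>o r'"
    by (rule exists_minim_Card_order)
  then have "\<exists>G. ?P G"
    by auto
  then have "?P (SOME G. ?P G)"
    by (rule someI_ex)
  then show thesis
    by (intro that[of "SOME G. ?P G"]) (auto simp: dispersion_character_def)
qed

definition resolvable :: "'a topology \<Rightarrow> 'b rel \<Rightarrow> bool" where
  "resolvable X \<mu> \<longleftrightarrow>
     (\<exists>\<D>. |\<D>| =o \<mu> \<and> (\<forall>D \<in> \<D>. dense_set X D) \<and> pairwise disjnt \<D>)"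

definition almost_resolvable :: "'a topology \<Rightarrow> 'b rel \<Rightarrow> bool" where
  "almost_resolvable X \<mu> \<longleftrightarrow>
     (\<exists>\<D>. |\<D>| =o \<mu> \<and> (\<forall>D \<in> \<D>. dense_set X D) \<and>
          pairwise (\<lambda>D E. nowhere_dense_set X (D \<inter> E)) \<D>)"

definition extraresolvable :: "'a topology \<Rightarrow> bool" where
  "extraresolvable X \<longleftrightarrow> almost_resolvable X (cardSuc (dispersion_character X))"

definition kappa_dense :: "'b rel \<Rightarrow> 'a topology \<Rightarrow> 'a set \<Rightarrow> bool" where
  "kappa_dense \<kappa> Y D \<longleftrightarrow>
     D \<subseteq> topspace Y \<and> (\<forall>U. openin Y U \<and> U \<noteq> {} \<longrightarrow> \<kappa> \<le>o |D \<inter> U| )"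

definition zero_dimensional_space :: "'a topology \<Rightarrow> bool" where
  "zero_dimensional_space X \<longleftrightarrow>
     (\<exists>\<B>. (\<forall>B \<in> \<B>. openin X B \<and> closedin X B) \<and>
          (\<forall>U. openin X U \<longrightarrow> (\<exists>\<U> \<subseteq> \<B>. U = \<Union>\<U>)))"

text \<open>The index set of the product is the underlying set \<open>Field \<mu>\<close> of the cardinal \<open>\<mu>\<close>.\<close>

definition cantor_cube :: "'i rel \<Rightarrow> ('i \<Rightarrow> bool) topology" where
  "cantor_cube \<mu> = product_topology (\<lambda>_. discrete_topology UNIV) (Field \<mu>)"

definition omega1 :: "nat set rel" where
  "omega1 = cardSuc natLeq"

end

theory Submission
  imports Defs
begin

text \<open>
  Fix on a set \<open>Z\<close> of size \<open>\<kappa>\<close> an independent family of \<open>2\<^sup>\<kappa>\<close> sets whose finite Boolean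
  combinations (cells) all have size \<open>\<kappa>\<close>, and an ideal \<open>\<I>\<close> that contains the sets of size less
  than \<open>\<kappa>\<close> and is maximal among the ideals containing no cell. By maximality every set outside \<open>\<I>\<close>
  contains a cell modulo \<open>\<I>\<close>, so the countable chain condition of the cells passes to \<open>\<I>\<close>: a
  disjoint family of sets outside \<open>\<I>\<close> is countable. Split the family into sets \<open>D s\<close> and \<open>B j\<close>.
  Change each \<open>B j\<close> on one exceptional set, which is a member of \<open>\<I>\<close> or an intersection
  \<open>D s \<inter> D t\<close> with \<open>s \<noteq> t\<close>, so that every exceptional set is avoided by infinitely many of the
  changed sets \<open>c j\<close>. Let \<open>X\<close> be the image of \<open>Z\<close> in the Cantor cube under the coordinates \<open>c j\<close>.
  The \<open>D s\<close> remain dense, since outside finitely many \<open>D t\<close> with \<open>t \<noteq> s\<close> and modulo \<open>\<I>\<close> nothing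
  has changed on \<open>D s\<close>; the exceptional sets become nowhere dense. So the \<open>D s\<close> witness almost
  \<open>2\<^sup>\<kappa>\<close>-resolvability, and a dense set is never in \<open>\<I>\<close>, whence disjoint dense sets are countable
  in number.
\<close>

subsection \<open>Cells and maximal ideals\<close>

text \<open>A pair \<open>(P, Q)\<close> codes a finite partial function from \<open>I\<close> to
  \<open>{0,1}\<close>, with \<open>P\<close> the preimage of 1 and \<open>Q\<close> that of 0: a
  Cohen condition, and equally a basic clopen box of the cube with index set
  \<open>I\<close>.\<close>

definition fin_cond :: "'i set \<Rightarrow> 'i set \<Rightarrow> 'i set \<Rightarrow> bool" where
  "fin_cond I P Q \<longleftrightarrow> finite P \<and> finite Q \<and> P \<subseteq> I \<and> Q \<subseteq> I \<and> P \<inter> Q = {}"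

text \<open>Intersecting with \<open>Z\<close> makes the empty condition yield \<open>Z\<close>
  itself and allows sets \<open>B i\<close> that stick out of \<open>Z\<close>.\<close>

definition cell :: "'z set \<Rightarrow> ('i \<Rightarrow> 'z set) \<Rightarrow> 'i set \<Rightarrow> 'i set \<Rightarrow> 'z set" where
  "cell Z B P Q = {z \<in> Z. (\<forall>i\<in>P. z \<in> B i) \<and> (\<forall>i\<in>Q. z \<notin> B i)}"

definition set_ideal :: "'z set \<Rightarrow> 'z set set \<Rightarrow> bool" where
  "set_ideal Z \<I> \<longleftrightarrow> \<I> \<subseteq> Pow Z \<and> {} \<in> \<I> \<and> (\<forall>A\<in>\<I>. \<forall>A'\<subseteq>A. A' \<in> \<I>) \<and>
     (\<forall>A\<in>\<I>. \<forall>A'\<in>\<I>. A \<union> A' \<in> \<I>)"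

definition independent_mod :: "'z set set \<Rightarrow> 'z set \<Rightarrow> ('i \<Rightarrow> 'z set) \<Rightarrow> 'i set \<Rightarrow> bool" where
  "independent_mod \<I> Z B I \<longleftrightarrow> (\<forall>P Q. fin_cond I P Q \<longrightarrow> cell Z B P Q \<notin> \<I>)"

lemma fin_cond_Un:
  assumes "fin_cond I P Q" "fin_cond I P' Q'" "P \<inter> Q' = {}" "P' \<inter> Q = {}"
  shows "fin_cond I (P \<union> P') (Q \<union> Q')"
  using assms unfolding fin_cond_def by blast

lemma cell_Un: "cell Z B (P \<union> P') (Q \<union> Q') = cell Z B P Q \<inter> cell Z B P' Q'"
  by (auto simp: cell_def)

lemma cell_subset: "cell Z B P Q \<subseteq> Z"
  by (auto simp: cell_def)

lemma set_ideal_subset: "set_ideal Z \<I> \<Longrightarrow> A \<in> \<I> \<Longrightarrow> A' \<subseteq> A \<Longrightarrow> A' \<in> \<I>"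
  unfolding set_ideal_def by blast

lemma set_ideal_Un: "set_ideal Z \<I> \<Longrightarrow> A \<in> \<I> \<Longrightarrow> A' \<in> \<I> \<Longrightarrow> A \<union> A' \<in> \<I>"
  unfolding set_ideal_def by blast

lemma set_ideal_empty: "set_ideal Z \<I> \<Longrightarrow> {} \<in> \<I>"
  unfolding set_ideal_def by blast

lemma set_ideal_into: "set_ideal Z \<I> \<Longrightarrow> A \<in> \<I> \<Longrightarrow> A \<subseteq> Z"
  unfolding set_ideal_def by blast

lemma set_ideal_UN:
  assumes "set_ideal Z \<I>" "finite J" "\<And>j. j \<in> J \<Longrightarrow> N j \<in> \<I>"
  shows "(\<Union>j\<in>J. N j) \<in> \<I>"
  using assms(2,3)
  by (induction J rule: finite_induct) (auto intro: set_ideal_empty[OF assms(1)] set_ideal_Un[OF assms(1)])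

lemma set_ideal_small_sets:
  fixes Z :: "'z set"
  assumes "Cinfinite \<kappa>"
  shows "set_ideal Z {A. A \<subseteq> Z \<and> |A| <o \<kappa>}"
proof -
  have "|{}::'z set| <o \<kappa>"
    using assms
    by (intro Cfinite_ordLess_Cinfinite) (auto simp: cfinite_def Field_card_of card_of_card_order_on)
  moreover have "|A'| <o \<kappa>" if "|A| <o \<kappa>" "A' \<subseteq> A" for A A' :: "'z set"
    using that card_of_mono1 ordLeq_ordLess_trans by blast
  moreover have "|A \<union> A'| <o \<kappa>" if "|A| <o \<kappa>" "|A'| <o \<kappa>" for A A' :: "'z set"
    using that assms card_of_Un_ordLess_infinite_Field[of \<kappa>] by (simp add: cinfinite_def)
  ultimately show ?thesis
    unfolding set_ideal_def by (auto; blast)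
qed

text \<open>Zorn's lemma applies because the union of a chain of ideals contains a cell only if one
  of them does. If a set \<open>A\<close> outside a maximal ideal contained no cell modulo that
  ideal, adjoining \<open>A\<close> would give a larger ideal without cells.\<close>

lemma maximal_independent_ideal:
  assumes I0: "set_ideal Z \<I>0" and ind0: "independent_mod \<I>0 Z B I"
  obtains \<I> where "set_ideal Z \<I>" "\<I>0 \<subseteq> \<I>" "independent_mod \<I> Z B I"
    "\<And>A. A \<subseteq> Z \<Longrightarrow> A \<notin> \<I> \<Longrightarrow> \<exists>P Q. fin_cond I P Q \<and> cell Z B P Q - A \<in> \<I>"
proof -
  let ?\<A> = "{\<I>. set_ideal Z \<I> \<and> \<I>0 \<subseteq> \<I> \<and> independent_mod \<I> Z B I}"
  have "\<exists>M\<in>?\<A>. \<forall>X\<in>?\<A>. M \<subseteq> X \<longrightarrow> X = M"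
  proof (rule subset_Zorn_nonempty)
    show "?\<A> \<noteq> {}"
      using I0 ind0 by blast
    fix \<C> assume ne: "\<C> \<noteq> {}" and "subset.chain ?\<A> \<C>"
    then have sub: "\<C> \<subseteq> ?\<A>" and ch: "\<And>X Y. X \<in> \<C> \<Longrightarrow> Y \<in> \<C> \<Longrightarrow> X \<subseteq> Y \<or> Y \<subseteq> X"
      by (auto simp: subset_chain_def)
    have ideals: "set_ideal Z X" and above: "\<I>0 \<subseteq> X" and ind: "independent_mod X Z B I"
      if "X \<in> \<C>" for X
      using that sub by auto
    have "A \<union> A' \<in> \<Union>\<C>" if AA: "A \<in> \<Union>\<C>" "A' \<in> \<Union>\<C>" for A A'
    proof -
      obtain X where "X \<in> \<C>" "A \<in> X" "A' \<in> X"
        using AA ch by blast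
      then show ?thesis
        using ideals set_ideal_Un by blast
    qed
    moreover have "A' \<in> \<Union>\<C>" if "A \<in> \<Union>\<C>" "A' \<subseteq> A" for A A'
      using that ideals set_ideal_subset by blast
    moreover have "{} \<in> \<Union>\<C>"
      using ne ideals set_ideal_empty by blast
    moreover have "\<Union>\<C> \<subseteq> Pow Z"
      using ideals set_ideal_into by blast
    ultimately have "set_ideal Z (\<Union>\<C>)"
      unfolding set_ideal_def by blast
    moreover have "\<I>0 \<subseteq> \<Union>\<C>"
      using ne above by blast
    moreover have "independent_mod (\<Union>\<C>) Z B I"
      using ind unfolding independent_mod_def by blast
    ultimately show "\<Union>\<C> \<in> ?\<A>"
      by simp
  qed
  then obtain \<I> where "\<I> \<in> ?\<A>" and max0: "\<forall>X\<in>?\<A>. \<I> \<subseteq> X \<longrightarrow> X = \<I>"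
    by (rule bexE)
  then have \<I>: "set_ideal Z \<I>" "\<I>0 \<subseteq> \<I>" "independent_mod \<I> Z B I"
    by simp_all
  have max: "\<J> = \<I>"
    if "set_ideal Z \<J>" "\<I>0 \<subseteq> \<J>" "independent_mod \<J> Z B I" "\<I> \<subseteq> \<J>" for \<J>
    using max0 that by simp
  have "\<exists>P Q. fin_cond I P Q \<and> cell Z B P Q - A \<in> \<I>" if A: "A \<subseteq> Z" "A \<notin> \<I>" for A
  proof (rule ccontr)
    assume neg: "\<not> ?thesis"
    \<comment> \<open>The ideal generated by \<open>\<I>\<close> and \<open>A\<close>; the negated
      claim says exactly that it contains no cell.\<close>
    define \<J> where "\<J> = {X. X \<subseteq> Z \<and> X - A \<in> \<I>}"
    have "X \<union> Y \<in> \<J>" if "X \<in> \<J>" "Y \<in> \<J>" for X Y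
      using that set_ideal_Un[OF \<I>(1)] unfolding \<J>_def by (auto simp: Un_Diff)
    moreover have "Y \<in> \<J>" if "X \<in> \<J>" "Y \<subseteq> X" for X Y
    proof -
      have "Y - A \<subseteq> X - A"
        using that by blast
      then show ?thesis
        using that set_ideal_subset[OF \<I>(1)] unfolding \<J>_def by blast
    qed
    moreover have "{} \<in> \<J>" "\<J> \<subseteq> Pow Z"
      using set_ideal_empty[OF \<I>(1)] by (auto simp: \<J>_def)
    ultimately have "set_ideal Z \<J>"
      unfolding set_ideal_def by blast
    moreover have "\<I> \<subseteq> \<J>"
    proof
      fix X assume "X \<in> \<I>"
      then show "X \<in> \<J>"
        using set_ideal_into[OF \<I>(1)] set_ideal_subset[OF \<I>(1), of X "X - A"] by (auto simp: \<J>_def)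
    qed
    moreover have "independent_mod \<J> Z B I"
      using neg unfolding independent_mod_def \<J>_def by auto
    ultimately have "\<J> = \<I>"
      using max \<I>(2) by auto
    moreover have "A \<in> \<J>"
      using A set_ideal_empty[OF \<I>(1)] by (simp add: \<J>_def)
    ultimately show False
      using A by blast
  qed
  then show thesis
    using that \<I> by blast
qed

section \<open>The countable chain condition\<close>

text \<open>
  A condition with \<open>n\<close> coordinates is met by the fraction \<open>2\<^sup>-\<^sup>n\<close> of the subsets of any finite set
  containing all coordinates in question. This counting replaces the Delta-system lemma.
\<close>

lemma card_incompatible_conditions:
  assumes "finite \<P>" and I: "\<And>P Q. (P, Q) \<in> \<P> \<Longrightarrow> fin_cond I P Q"
    and n: "\<And>P Q. (P, Q) \<in> \<P> \<Longrightarrow> card P + card Q = n"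
    and inc: "\<And>P Q P' Q'. (P, Q) \<in> \<P> \<Longrightarrow> (P', Q') \<in> \<P> \<Longrightarrow> (P, Q) \<noteq> (P', Q') \<Longrightarrow>
      P \<inter> Q' \<noteq> {} \<or> P' \<inter> Q \<noteq> {}"
  shows "card \<P> \<le> 2 ^ n"
proof (cases "\<P> = {}")
  case False
  define U where "U = (\<Union>(P, Q)\<in>\<P>. P \<union> Q)"
  \<comment> \<open>\<open>E p\<close> collects the subsets of \<open>U\<close> that agree with the
    condition \<open>p\<close>; incompatible conditions give disjoint collections inside
    \<open>Pow U\<close>.\<close>
  define E where "E = (\<lambda>(P, Q). {W. P \<subseteq> W \<and> W \<subseteq> U - Q})"
  have finU: "finite U"
    using \<open>finite \<P>\<close> I unfolding U_def fin_cond_def by auto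
  have sub: "P \<subseteq> U" "Q \<subseteq> U" if "(P, Q) \<in> \<P>" for P Q
    using that unfolding U_def by auto
  have fin: "finite P" "finite Q" "P \<inter> Q = {}" if "(P, Q) \<in> \<P>" for P Q
    using I[OF that] unfolding fin_cond_def by auto
  \<comment> \<open>Excludes truncated subtraction, so that \<open>2 ^ card U\<close> splits exactly
    as \<open>2 ^ n * 2 ^ (card U - n)\<close>.\<close>
  have nU: "n \<le> card U"
  proof -
    obtain P Q where PQ: "(P, Q) \<in> \<P>"
      using False by auto
    have "card (P \<union> Q) \<le> card U"
      using sub[OF PQ] finU by (intro card_mono) auto
    then show ?thesis
      using n[OF PQ] fin[OF PQ] by (simp add: card_Un_disjoint)
  qed
  have cE: "card (E p) = 2 ^ (card U - n)" if "p \<in> \<P>" for p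
  proof -
    obtain P Q where p: "p = (P, Q)"
      by fastforce
    note PQ = that[unfolded p]
    have "E p = (\<lambda>W. P \<union> W) ` Pow (U - (P \<union> Q))" (is "_ = ?f ` ?S")
    proof (intro equalityI subsetI)
      fix W assume "W \<in> E p"
      then have "W = P \<union> (W - P)" "W - P \<in> ?S"
        by (auto simp: E_def p)
      then show "W \<in> ?f ` ?S"
        by blast
    next
      fix W assume "W \<in> ?f ` ?S"
      then show "W \<in> E p"
        using sub[OF PQ] fin[OF PQ] by (auto simp: E_def p)
    qed
    moreover have "inj_on ?f ?S"
      by (rule inj_onI) blast
    ultimately have "card (E p) = 2 ^ card (U - (P \<union> Q))"
      using finU by (simp add: card_image card_Pow)
    also have "card (U - (P \<union> Q)) = card U - n"
      using sub[OF PQ] fin[OF PQ] n[OF PQ] by (simp add: card_Diff_subset card_Un_disjoint)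
    finally show ?thesis .
  qed
  have disj: "E p \<inter> E q = {}" if pq: "p \<in> \<P>" "q \<in> \<P>" "p \<noteq> q" for p q
  proof -
    obtain P Q P' Q' where "p = (P, Q)" "q = (P', Q')"
      by fastforce
    then show ?thesis
      using inc[of P Q P' Q'] pq by (auto simp: E_def)
  qed
  have E_sub: "E p \<subseteq> Pow U" for p
    by (cases p) (auto simp: E_def)
  then have "finite (E p)" for p
    using finU by (meson finite_Pow_iff finite_subset)
  then have "card (\<Union>p\<in>\<P>. E p) = (\<Sum>p\<in>\<P>. card (E p))"
    using \<open>finite \<P>\<close> disj by (intro card_UN_disjoint) auto
  also have "\<dots> = card \<P> * 2 ^ (card U - n)"
    by (simp add: cE)
  finally have "card \<P> * 2 ^ (card U - n) \<le> card (Pow U)"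
    using E_sub finU by (metis UN_least card_mono finite_Pow_iff)
  also have "\<dots> = 2 ^ n * 2 ^ (card U - n)"
    using finU nU by (simp add: card_Pow flip: power_add)
  finally show ?thesis
    by simp
qed simp

text \<open>Conditions fall into countably many classes by size. An uncountable family has an
  infinite class, and \<open>2 ^ n + 1\<close> of its members cannot be pairwise
  incompatible.\<close>

lemma uncountable_conditions_compatible:
  assumes unc: "\<not> countable S" and I: "\<And>x. x \<in> S \<Longrightarrow> fin_cond I (P x) (Q x)"
  obtains x y where "x \<in> S" "y \<in> S" "x \<noteq> y" "P x \<inter> Q y = {}" "P y \<inter> Q x = {}"
proof (rule ccontr)
  assume "\<not> thesis"
  with that have inc: "P x \<inter> Q y \<noteq> {} \<or> P y \<inter> Q x \<noteq> {}" if "x \<in> S" "y \<in> S" "x \<noteq> y" for x y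
    using \<open>x \<in> S\<close> \<open>y \<in> S\<close> \<open>x \<noteq> y\<close> by blast
  define T where "T n = {x \<in> S. card (P x) + card (Q x) = n}" for n
  have "S = (\<Union>n. T n)"
    unfolding T_def by blast
  then obtain n where "\<not> countable (T n)"
    using unc by auto
  then have "infinite (T n)"
    using countable_finite by blast
  then obtain F where F: "F \<subseteq> T n" "finite F" "card F = 2 ^ n + 1"
    using infinite_arbitrarily_large by blast
  let ?g = "\<lambda>x. (P x, Q x)"
  have FS: "x \<in> S" "card (P x) + card (Q x) = n" if "x \<in> F" for x
    using that F unfolding T_def by auto
  \<comment> \<open>Equal conditions are compatible, as \<open>P x\<close> and \<open>Q x\<close>
    are disjoint, so \<open>F\<close> yields as many conditions as it has elements.\<close>
  have "inj_on ?g F"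
  proof (rule inj_onI, rule ccontr)
    fix x y assume xy: "x \<in> F" "y \<in> F" "?g x = ?g y" "x \<noteq> y"
    then show False
      using inc[OF FS(1) FS(1), of x y] I[OF FS(1), of x] by (simp add: fin_cond_def)
  qed
  moreover have "card (?g ` F) \<le> 2 ^ n"
  proof (rule card_incompatible_conditions)
    show "finite (?g ` F)"
      using F by simp
    show "fin_cond I P' Q'" if "(P', Q') \<in> ?g ` F" for P' Q'
      using that I FS by auto
    show "card P' + card Q' = n" if "(P', Q') \<in> ?g ` F" for P' Q'
      using that FS by auto
    show "P' \<inter> Q'' \<noteq> {} \<or> P'' \<inter> Q' \<noteq> {}"
      if p: "(P', Q') \<in> ?g ` F" "(P'', Q'') \<in> ?g ` F" "(P', Q') \<noteq> (P'', Q'')" for P' Q' P'' Q''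
    proof -
      obtain x where "x \<in> F" "P' = P x" "Q' = Q x"
        using p(1) by blast
      moreover obtain y where "y \<in> F" "P'' = P y" "Q'' = Q y"
        using p(2) by blast
      ultimately show ?thesis
        using inc[of x y] FS p(3) by auto
    qed
  qed
  ultimately show False
    using F(3) by (simp add: card_image)
qed

text \<open>Each member of the family contains a cell modulo the ideal. Among uncountably many, two
  such cells have compatible conditions and meet in a cell, which disjointness of the two members
  would force into the ideal.\<close>

lemma disjoint_positive_sets_countable:
  assumes ideal: "set_ideal Z \<I>" and ind: "independent_mod \<I> Z B I"
    and pos: "\<And>A. A \<subseteq> Z \<Longrightarrow> A \<notin> \<I> \<Longrightarrow> \<exists>P Q. fin_cond I P Q \<and> cell Z B P Q - A \<in> \<I>"
    and E: "\<And>A. A \<in> \<E> \<Longrightarrow> A \<subseteq> Z \<and> A \<notin> \<I>" and disj: "pairwise disjnt \<E>"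
  shows "countable \<E>"
proof (rule ccontr)
  assume unc: "\<not> countable \<E>"
  have "\<forall>A\<in>\<E>. \<exists>P Q. fin_cond I P Q \<and> cell Z B P Q - A \<in> \<I>"
    using E pos by blast
  then obtain P Q where PQ: "\<And>A. A \<in> \<E> \<Longrightarrow> fin_cond I (P A) (Q A) \<and> cell Z B (P A) (Q A) - A \<in> \<I>"
    by metis
  then obtain A A' where A: "A \<in> \<E>" "A' \<in> \<E>" "A \<noteq> A'" "P A \<inter> Q A' = {}" "P A' \<inter> Q A = {}"
    using uncountable_conditions_compatible[OF unc, of I P Q] by blast
  have "cell Z B (P A \<union> P A') (Q A \<union> Q A') \<notin> \<I>"
    using ind fin_cond_Un[of I "P A" "Q A" "P A'" "Q A'"] A PQ unfolding independent_mod_def by blast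
  moreover have "(cell Z B (P A) (Q A) - A) \<union> (cell Z B (P A') (Q A') - A') \<in> \<I>"
    using PQ A set_ideal_Un[OF ideal] by blast
  moreover have "cell Z B (P A \<union> P A') (Q A \<union> Q A') \<subseteq>
      (cell Z B (P A) (Q A) - A) \<union> (cell Z B (P A') (Q A') - A')"
    using disj A unfolding cell_Un pairwise_def disjnt_def by blast
  ultimately show False
    using set_ideal_subset[OF ideal] by blast
qed

subsection \<open>Independent families\<close>

lemma card_of_lists_infinite:
  assumes "infinite K"
  shows "|lists K| \<le>o |K|"
proof -
  have len: "|{l \<in> lists K. length l = n}| \<le>o |K|" for n
  proof (induction n)
    case 0
    have "{l \<in> lists K. length l = 0} = {[]}"
      by auto
    then show ?case
      using assms by (metis card_of_singl_ordLeq finite.emptyI)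
  next
    case (Suc n)
    have "{l \<in> lists K. length l = Suc n} \<subseteq> (\<lambda>(a, l). a # l) ` (K \<times> {l \<in> lists K. length l = n})"
      by (force simp: length_Suc_conv)
    then have "|{l \<in> lists K. length l = Suc n}| \<le>o |K \<times> {l \<in> lists K. length l = n}|"
      by (rule surj_imp_ordLeq)
    also have "|K \<times> {l \<in> lists K. length l = n}| \<le>o |K|"
      using assms Suc by (intro card_of_Times_ordLeq_infinite_Field) (simp_all add: Field_card_of card_of_mono1 card_of_card_order_on)
    finally show ?case .
  qed
  have "|\<Union>n\<in>(UNIV::nat set). {l \<in> lists K. length l = n}| \<le>o |K|"
    using assms len infinite_iff_card_of_nat by (intro card_of_UNION_ordLeq_infinite) auto
  also have "(\<Union>n\<in>(UNIV::nat set). {l \<in> lists K. length l = n}) = lists K"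
    by auto
  finally show ?thesis .
qed

text \<open>A point of the symmetric difference is picked for each of the finitely many pairs of
  distinct members. The finite set obtained is to be enumerated by the list in a point of
  Hausdorff's family.\<close>

lemma finite_separating_set:
  fixes K :: "'k set"
  assumes "finite \<S>" "\<And>S. S \<in> \<S> \<Longrightarrow> S \<subseteq> K"
  obtains F where "finite F" "F \<subseteq> K" "\<And>S T. S \<in> \<S> \<Longrightarrow> T \<in> \<S> \<Longrightarrow> S \<inter> F = T \<inter> F \<Longrightarrow> S = T"
proof -
  let ?D = "{(S, T) \<in> \<S> \<times> \<S>. S \<noteq> T}"
  define d :: "'k set \<times> 'k set \<Rightarrow> 'k" where "d = (\<lambda>(S, T). SOME a. a \<in> (S - T) \<union> (T - S))"
  have d: "d (S, T) \<in> (S - T) \<union> (T - S)" if "S \<noteq> T" for S T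
    unfolding d_def prod.case by (rule someI_ex) (use that in blast)
  have sep: "S = T" if S: "S \<in> \<S>" "T \<in> \<S>" and eq: "S \<inter> d ` ?D = T \<inter> d ` ?D" for S T
  proof (rule ccontr)
    assume "S \<noteq> T"
    then have dD: "d (S, T) \<in> d ` ?D"
      using S by (intro imageI) simp
    have "d (S, T) \<in> S \<inter> d ` ?D \<longleftrightarrow> d (S, T) \<in> T \<inter> d ` ?D"
      unfolding eq by (rule refl)
    with dD have "d (S, T) \<in> S \<longleftrightarrow> d (S, T) \<in> T"
      by (simp only: Int_iff simp_thms)
    with d[OF \<open>S \<noteq> T\<close>] show False
      by (simp only: Un_iff Diff_iff simp_thms)
  qed
  have "finite (d ` ?D)"
    using assms by (intro finite_imageI finite_subset[of ?D "\<S> \<times> \<S>"]) auto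
  moreover have "d ` ?D \<subseteq> K"
  proof clarify
    fix S T assume "S \<in> \<S>" "T \<in> \<S>" "S \<noteq> T"
    then show "d (S, T) \<in> K"
      using d[of S T] assms(2) by blast
  qed
  ultimately show thesis
    using sep by (rule that)
qed

text \<open>
  Hausdorff's independent family: the second component \<open>g\<close> of a point lists the permitted traces of
  \<open>S\<close> on the finite set enumerated by \<open>l\<close>.
\<close>

lemma large_cells:
  fixes K :: "'k set"
  defines "Z \<equiv> lists K \<times> lists (lists K)"
    and "B \<equiv> \<lambda>S. {(l, g). filter (\<lambda>a. a \<in> S) l \<in> set g}"
  assumes PQ: "fin_cond (Pow K) P Q"
  shows "|K| \<le>o |cell Z B P Q|"
proof -
  let ?f = "\<lambda>l S. filter (\<lambda>a. a \<in> S) l"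
  have fin: "finite (P \<union> Q)" "\<And>S. S \<in> P \<union> Q \<Longrightarrow> S \<subseteq> K" "finite P" "P \<inter> Q = {}"
    using PQ unfolding fin_cond_def by auto
  obtain F where F: "finite F" "F \<subseteq> K"
    "\<And>S T. S \<in> P \<union> Q \<Longrightarrow> T \<in> P \<union> Q \<Longrightarrow> S \<inter> F = T \<inter> F \<Longrightarrow> S = T"
    using finite_separating_set[OF fin(1,2)] by metis
  obtain l where l: "set l = F"
    using F(1) finite_list by blast
  have "\<exists>g. set g = ?f (a # l) ` P" for a
    using fin(3) by (intro finite_list finite_imageI)
  then obtain g where g: "\<And>a. set (g a) = ?f (a # l) ` P"
    by metis
  \<comment> \<open>The list \<open>g a\<close> permits exactly the traces of the sets in
    \<open>P\<close>. The head \<open>a\<close> runs freely through \<open>K\<close> and gives the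
    cell one point per element of \<open>K\<close>.\<close>
  have "(\<lambda>a. (a # l, g a)) ` K \<subseteq> cell Z B P Q"
  proof clarify
    fix a assume "a \<in> K"
    then have al: "a # l \<in> lists K"
      using l F(2) by auto
    then have gl: "g a \<in> lists (lists K)"
      using g[of a] by (fastforce simp: in_lists_conv_set)
    have "?f (a # l) S \<notin> set (g a)" if "S \<in> Q" for S
    proof
      assume "?f (a # l) S \<in> set (g a)"
      then obtain T where T: "T \<in> P" "?f (a # l) S = ?f (a # l) T"
        unfolding g by blast
      have "set (?f (a # l) S) = set (?f (a # l) T)"
        using T(2) by simp
      \<comment> \<open>Intersecting with \<open>F\<close> discards the head \<open>a\<close>, which
        need not lie in \<open>F\<close>.\<close>
      moreover have "S' \<inter> F = set (?f (a # l) S') \<inter> F" for S'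
        using l by auto
      ultimately have "S \<inter> F = T \<inter> F"
        by metis
      then show False
        using F(3) T(1) that fin(4) by blast
    qed
    moreover have "?f (a # l) S \<in> set (g a)" if "S \<in> P" for S
      using that g by blast
    ultimately show "(a # l, g a) \<in> cell Z B P Q"
      using al gl unfolding cell_def Z_def B_def by blast
  qed
  moreover have "inj_on (\<lambda>a. (a # l, g a)) K"
    by (rule inj_onI) simp
  ultimately show ?thesis
    using card_of_ordLeq by blast
qed

lemma independent_mod_comp:
  assumes "independent_mod \<I> Z B J" "inj_on h I" "h ` I \<subseteq> J"
  shows "independent_mod \<I> Z (B \<circ> h) I"
  unfolding independent_mod_def
proof (intro allI impI)
  fix P Q assume PQ: "fin_cond I P Q"
  then have "fin_cond J (h ` P) (h ` Q)"
    using assms(2,3) inj_on_image_Int[OF assms(2), of P Q] unfolding fin_cond_def by (simp add: image_subset_iff subset_iff image_iff) blast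
  moreover have "cell Z (B \<circ> h) P Q = cell Z B (h ` P) (h ` Q)"
    by (auto simp: cell_def)
  ultimately show "cell Z (B \<circ> h) P Q \<notin> \<I>"
    using assms(1) by (simp add: independent_mod_def)
qed

text \<open>Hausdorff's family is reindexed along an injection into
  \<open>Pow (Field \<kappa>)\<close>, and the maximal ideal is taken above the ideal of sets
  smaller than \<kappa>. So sets outside it have full size, while disjoint ones are only countably
  many.\<close>

lemma independent_family_exists:
  fixes \<kappa> :: "'k rel" and I :: "'i set"
  assumes \<kappa>: "Cinfinite \<kappa>" and I: "|I| \<le>o |Pow (Field \<kappa>)|"
  obtains Z :: "('k list \<times> 'k list list) set" and \<I> B where
    "|Z| =o \<kappa>" "set_ideal Z \<I>" "independent_mod \<I> Z B I"
    "\<And>A. A \<subseteq> Z \<Longrightarrow> |A| <o \<kappa> \<Longrightarrow> A \<in> \<I>"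
    "\<And>\<E>. (\<And>A. A \<in> \<E> \<Longrightarrow> A \<subseteq> Z \<and> A \<notin> \<I>) \<Longrightarrow> pairwise disjnt \<E> \<Longrightarrow> countable \<E>"
proof -
  let ?K = "Field \<kappa>"
  define Z where "Z = lists ?K \<times> lists (lists ?K)"
  define B0 :: "'k set \<Rightarrow> ('k list \<times> 'k list list) set" where "B0 = (\<lambda>S. {(l, g). filter (\<lambda>a. a \<in> S) l \<in> set g})"
  have K: "infinite ?K" "|?K| =o \<kappa>"
    using \<kappa> card_of_Field_ordIso by (auto simp: cinfinite_def)
  have large: "|?K| \<le>o |cell Z B0 P Q|" if "fin_cond (Pow ?K) P Q" for P Q
    unfolding Z_def B0_def using that by (rule large_cells)
  have "|?K| \<le>o |cell Z B0 {} {}|"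
    by (rule large) (simp add: fin_cond_def)
  then have KZ: "|?K| \<le>o |Z|"
    by (simp add: cell_def)
  have lists: "|lists ?K| \<le>o |?K|"
    using K(1) by (rule card_of_lists_infinite)
  have "\<not> finite (lists ?K)"
  proof
    assume "finite (lists ?K)"
    moreover have "(\<lambda>a. [a]) ` ?K \<subseteq> lists ?K"
      by auto
    ultimately show False
      using K(1) by (metis finite_imageD finite_subset inj_onI list.inject)
  qed
  then have "|lists (lists ?K)| \<le>o |?K|"
    using card_of_lists_infinite lists ordLeq_transitive by blast
  with lists have "|Z| \<le>o |?K|"
    unfolding Z_def using K(1)
    by (intro card_of_Times_ordLeq_infinite_Field) (simp_all add: Field_card_of card_of_card_order_on)
  with KZ have Z: "|Z| =o \<kappa>"
    using K(2) ordIso_iff_ordLeq ordIso_transitive by blast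
  define \<I>0 where "\<I>0 = {A. A \<subseteq> Z \<and> |A| <o \<kappa>}"
  have "independent_mod \<I>0 Z B0 (Pow ?K)"
    unfolding independent_mod_def
  proof (intro allI impI notI)
    fix P Q assume PQ: "fin_cond (Pow ?K) P Q" and "cell Z B0 P Q \<in> \<I>0"
    then have "|cell Z B0 P Q| <o \<kappa>"
      by (simp add: \<I>0_def)
    then have "|cell Z B0 P Q| <o |?K|"
      using K(2) ordIso_symmetric ordLess_ordIso_trans by blast
    then show False
      using large[OF PQ] not_ordLess_ordLeq by blast
  qed
  moreover obtain h where "inj_on h I" "h ` I \<subseteq> Pow ?K"
    using I card_of_ordLeq by metis
  ultimately have "independent_mod \<I>0 Z (B0 \<circ> h) I"
    by (rule independent_mod_comp)
  moreover have "set_ideal Z \<I>0"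
    unfolding \<I>0_def using \<kappa> by (rule set_ideal_small_sets)
  ultimately obtain \<I> where \<I>: "set_ideal Z \<I>" "\<I>0 \<subseteq> \<I>" "independent_mod \<I> Z (B0 \<circ> h) I"
    "\<And>A. A \<subseteq> Z \<Longrightarrow> A \<notin> \<I> \<Longrightarrow> \<exists>P Q. fin_cond I P Q \<and> cell Z (B0 \<circ> h) P Q - A \<in> \<I>"
    using maximal_independent_ideal by metis
  show thesis
  proof (rule that[OF Z \<I>(1) \<I>(3)])
    show "A \<in> \<I>" if "A \<subseteq> Z" "|A| <o \<kappa>" for A
      using that \<I>(2) by (auto simp: \<I>0_def)
    show "countable \<E>" if "\<And>A. A \<in> \<E> \<Longrightarrow> A \<subseteq> Z \<and> A \<notin> \<I>" "pairwise disjnt \<E>" for \<E>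
      using disjoint_positive_sets_countable[OF \<I>(1) \<I>(3) \<I>(4) that] .
  qed
qed

section \<open>Changing coordinates on exceptional sets\<close>

text \<open>Inside \<open>D s\<close> an intersection of two different members of the family
  \<open>D\<close> is covered by one of them other than \<open>D s\<close>. Cutting off finitely
  many such sets leaves a cell of the original family on which, modulo the ideal, no coordinate in
  \<open>P \<union> Q\<close> has changed.\<close>

lemma cell_of_modified_family:
  assumes ideal: "set_ideal Z \<I>" and ind: "independent_mod \<I> Z (case_sum D B) (C <+> C)"
    and M: "\<And>j. j \<in> C \<Longrightarrow> M j \<in> \<I> \<or> (\<exists>s\<in>C. \<exists>t\<in>C. s \<noteq> t \<and> M j = D s \<inter> D t)"
    and c: "\<And>j. j \<in> C \<Longrightarrow> c j - M j = B j - M j"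
    and s: "s \<in> C" and PQ: "fin_cond C P Q"
  shows "cell Z c P Q \<inter> D s \<notin> \<I>"
proof
  assume small: "cell Z c P Q \<inter> D s \<in> \<I>"
  let ?J = "P \<union> Q"
  have J: "?J \<subseteq> C" "finite ?J"
    using PQ by (auto simp: fin_cond_def)
  \<comment> \<open>\<open>T\<close> is the index of the set to be cut off; the default
    \<open>T = s\<close> stands for cutting off nothing, when \<open>N\<close> alone
    suffices.\<close>
  have "\<forall>j\<in>?J. \<exists>N T. N \<in> \<I> \<and> T \<in> C - {s} \<and> M j \<inter> D s \<subseteq> N \<union> D T \<or>
      N \<in> \<I> \<and> T = s \<and> M j \<inter> D s \<subseteq> N"
  proof
    fix j assume "j \<in> ?J"
    then consider "M j \<in> \<I>" | u t where "u \<in> C" "t \<in> C" "u \<noteq> t" "M j = D u \<inter> D t"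
      using M J by blast
    then show "\<exists>N T. N \<in> \<I> \<and> T \<in> C - {s} \<and> M j \<inter> D s \<subseteq> N \<union> D T \<or>
        N \<in> \<I> \<and> T = s \<and> M j \<inter> D s \<subseteq> N"
    proof cases
      case 1
      then show ?thesis
        by blast
    next
      case 2
      define T where "T = (if u = s then t else u)"
      have "T \<in> C - {s} \<and> M j \<inter> D s \<subseteq> {} \<union> D T"
        using 2 by (auto simp: T_def)
      then show ?thesis
        using set_ideal_empty[OF ideal] by blast
    qed
  qed
  then obtain N T where NT: "\<And>j. j \<in> ?J \<Longrightarrow> N j \<in> \<I> \<and> T j \<in> C - {s} \<and> M j \<inter> D s \<subseteq> N j \<union> D (T j) \<or>
      N j \<in> \<I> \<and> T j = s \<and> M j \<inter> D s \<subseteq> N j"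
    by metis
  \<comment> \<open>Removing \<open>s\<close> drops the default values and keeps the two sides of
    the condition disjoint.\<close>
  let ?P = "insert (Inl s) (Inr ` P)" and ?Q = "Inl ` (T ` ?J - {s}) \<union> Inr ` Q"
  have "fin_cond (C <+> C) ?P ?Q"
    using PQ s NT J(1) unfolding fin_cond_def by auto
  then have "cell Z (case_sum D B) ?P ?Q \<notin> \<I>"
    using ind by (simp add: independent_mod_def)
  moreover have "cell Z (case_sum D B) ?P ?Q \<subseteq> (cell Z c P Q \<inter> D s) \<union> (\<Union>j\<in>?J. N j)"
  proof
    fix z assume z: "z \<in> cell Z (case_sum D B) ?P ?Q"
    then have zZ: "z \<in> Z" and zP: "\<And>i. i \<in> ?P \<Longrightarrow> z \<in> case_sum D B i"
      and zQ: "\<And>i. i \<in> ?Q \<Longrightarrow> z \<notin> case_sum D B i"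
      unfolding cell_def by blast+
    have zD: "z \<in> D s"
      using zP[of "Inl s"] by simp
    show "z \<in> (cell Z c P Q \<inter> D s) \<union> (\<Union>j\<in>?J. N j)"
    proof (cases "z \<in> (\<Union>j\<in>?J. N j)")
      case False
      have "z \<in> c j \<longleftrightarrow> z \<in> B j" if "j \<in> ?J" for j
      proof -
        have "z \<notin> D (T j)" if "T j \<noteq> s"
          using zQ[of "Inl (T j)"] \<open>j \<in> ?J\<close> that by simp
        then have "z \<notin> M j"
          using NT[OF that] False that zD by blast
        then show ?thesis
          using c[of j] that J by blast
      qed
      moreover have "z \<in> B j" if "j \<in> P" for j
        using zP[of "Inr j"] that by simp
      moreover have "z \<notin> B j" if "j \<in> Q" for j
        using zQ[of "Inr j"] that by simp
      ultimately have "z \<in> cell Z c P Q"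
        using zZ by (simp add: cell_def)
      then show ?thesis
        using zD by blast
    qed simp
  qed
  moreover have "(cell Z c P Q \<inter> D s) \<union> (\<Union>j\<in>?J. N j) \<in> \<I>"
    using NT J(2) by (intro set_ideal_Un[OF ideal small] set_ideal_UN[OF ideal]) auto
  ultimately show False
    using set_ideal_subset[OF ideal] by blast
qed

text \<open>There are at most \<open>2^\<kappa>\<close> pairs of subsets of \<open>Z\<close>, so the
  coordinates in \<open>C\<close> can serve every pair, each infinitely often. Avoiding
  \<open>W\<close> is coded by \<open>({}, W)\<close>, separating \<open>x\<close> from
  \<open>y\<close> by \<open>({x}, {y})\<close>; the latter changes only a finite set, which lies in
  the ideal.\<close>

lemma modified_family_exists:
  fixes \<kappa> :: "'k rel" and C :: "'i set"
  assumes \<kappa>: "Cinfinite \<kappa>" and C: "|C| =o |Pow (Field \<kappa>)|"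
  obtains Z :: "('k list \<times> 'k list list) set" and \<I> D c where
    "|Z| =o \<kappa>" "set_ideal Z \<I>"
    "\<And>A. A \<subseteq> Z \<Longrightarrow> |A| <o \<kappa> \<Longrightarrow> A \<in> \<I>"
    "\<And>\<E>. (\<And>A. A \<in> \<E> \<Longrightarrow> A \<subseteq> Z \<and> A \<notin> \<I>) \<Longrightarrow> pairwise disjnt \<E> \<Longrightarrow> countable \<E>"
    "inj_on D C" "\<And>s. D s \<subseteq> Z"
    "\<And>s P Q. s \<in> C \<Longrightarrow> fin_cond C P Q \<Longrightarrow> cell Z c P Q \<inter> D s \<notin> \<I>"
    "\<And>M F. finite F \<Longrightarrow> M \<in> \<I> \<or> (\<exists>s\<in>C. \<exists>t\<in>C. s \<noteq> t \<and> M = D s \<inter> D t) \<Longrightarrow> \<exists>j\<in>C - F. c j \<inter> M = {}"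
    "\<And>x y. x \<in> Z \<Longrightarrow> y \<in> Z \<Longrightarrow> x \<noteq> y \<Longrightarrow> \<exists>j\<in>C. x \<in> c j \<and> y \<notin> c j"
proof -
  have K: "infinite (Field \<kappa>)" "|Field \<kappa>| =o \<kappa>"
    using \<kappa> card_of_Field_ordIso by (auto simp: cinfinite_def)
  have KC: "|Field \<kappa>| \<le>o |C|"
    using C card_of_Pow ordIso_symmetric ordLess_imp_ordLeq ordLeq_ordIso_trans by blast
  then have infC: "infinite C"
    using K(1) card_of_ordLeq_infinite by blast
  have "|C <+> C| =o |C|"
    using infC card_of_Plus_infinite by (metis card_of_mono1 subset_refl)
  then have CC: "|C <+> C| \<le>o |Pow (Field \<kappa>)|"
    using C ordIso_transitive ordIso_imp_ordLeq by blast
  obtain Z :: "('k list \<times> 'k list list) set" and \<I> and G :: "'i + 'i \<Rightarrow> ('k list \<times> 'k list list) set"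
    where Z: "|Z| =o \<kappa>" "set_ideal Z \<I>" and ind: "independent_mod \<I> Z G (C <+> C)"
      and small: "\<And>A. A \<subseteq> Z \<Longrightarrow> |A| <o \<kappa> \<Longrightarrow> A \<in> \<I>"
      and ccc: "\<And>\<E>. (\<And>A. A \<in> \<E> \<Longrightarrow> A \<subseteq> Z \<and> A \<notin> \<I>) \<Longrightarrow> pairwise disjnt \<E> \<Longrightarrow> countable \<E>"
    by (fact independent_family_exists[OF \<kappa> CC])
  \<comment> \<open>The intersection gives \<open>D s \<subseteq> Z\<close> and changes no cell,
    since cells lie in \<open>Z\<close> anyway.\<close>
  define D where "D s = Z \<inter> G (Inl s)" for s
  define B where "B j = G (Inr j)" for j
  have "cell Z (case_sum D B) P Q = cell Z G P Q" for P Q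
  proof -
    have "z \<in> case_sum D B p \<longleftrightarrow> z \<in> G p" if "z \<in> Z" for z p
      using that by (cases p) (auto simp: D_def B_def)
    then show ?thesis
      by (auto simp: cell_def)
  qed
  then have ind': "independent_mod \<I> Z (case_sum D B) (C <+> C)"
    using ind by (simp add: independent_mod_def)
  let ?ok = "\<lambda>M. M \<in> \<I> \<or> (\<exists>s\<in>C. \<exists>t\<in>C. s \<noteq> t \<and> M = D s \<inter> D t)"
  \<comment> \<open>A key \<open>((U, V), n)\<close> asks for \<open>U\<close> to be added to a set and \<open>V\<close> removed from it; the number \<open>n\<close>
    only makes every request occur infinitely often.\<close>
  let ?keys = "(Pow Z \<times> Pow Z) \<times> (UNIV :: nat set)"
  have PowZ: "|Pow Z| \<le>o |C|"
  proof -
    have "|Z| \<le>o |Field \<kappa>|"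
      using Z(1) K(2) ordIso_symmetric ordIso_transitive ordIso_imp_ordLeq by blast
    then obtain h where "inj_on h Z" "h ` Z \<subseteq> Field \<kappa>"
      using card_of_ordLeq by metis
    then have "inj_on ((`) h) (Pow Z)" "(`) h ` Pow Z \<subseteq> Pow (Field \<kappa>)"
      by (auto intro: inj_on_image_Pow)
    then have "|Pow Z| \<le>o |Pow (Field \<kappa>)|"
      using card_of_ordLeq by metis
    then show ?thesis
      using C ordIso_symmetric ordLeq_ordIso_trans by blast
  qed
  then have "|Pow Z \<times> Pow Z| \<le>o |C|"
    using infC
    by (intro card_of_Times_ordLeq_infinite_Field) (simp_all add: Field_card_of card_of_card_order_on)
  then have "|?keys| \<le>o |C|"
    using infC infinite_iff_card_of_nat[of C]
    by (intro card_of_Times_ordLeq_infinite_Field[of "|C|" "Pow Z \<times> Pow Z"])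
      (simp_all add: Field_card_of card_of_card_order_on)
  moreover have "?keys \<noteq> {}"
    by auto
  ultimately obtain k where k: "k ` C = ?keys"
    using card_of_ordLeq2 by metis
  define U where "U j = fst (fst (k j))" for j
  define V where "V j = snd (fst (k j))" for j
  \<comment> \<open>A request whose total change is not exceptional is ignored: \<open>c j\<close>
    stays \<open>B j\<close>, and \<open>{}\<close>, a member of the ideal, serves as its
    exceptional set.\<close>
  define M where "M j = (if ?ok (U j \<union> V j) then U j \<union> V j else {})" for j
  define c where "c j = (if ?ok (U j \<union> V j) then (B j \<union> U j) - V j else B j)" for j
  have surj: "\<exists>j\<in>C. k j = ((X, Y), n)" if "X \<subseteq> Z" "Y \<subseteq> Z" for X Y n
  proof -
    have "((X, Y), n) \<in> k ` C"
      unfolding k using that by simp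
    then show ?thesis
      by (metis imageE)
  qed
  have DZ: "D s \<subseteq> Z" for s
    by (simp add: D_def)
  have injD: "inj_on D C"
  proof (rule inj_onI, rule ccontr)
    fix s t assume st: "s \<in> C" "t \<in> C" "D s = D t" "s \<noteq> t"
    then have "fin_cond (C <+> C) {Inl s} {Inl t}"
      by (auto simp: fin_cond_def)
    then have "cell Z (case_sum D B) {Inl s} {Inl t} \<notin> \<I>"
      using ind' unfolding independent_mod_def by blast
    moreover have "cell Z (case_sum D B) {Inl s} {Inl t} = {}"
      using st by (simp add: cell_def)
    ultimately show False
      using set_ideal_empty[OF Z(2)] by simp
  qed
  have cells: "cell Z c P Q \<inter> D s \<notin> \<I>" if "s \<in> C" "fin_cond C P Q" for s P Q
  proof (rule cell_of_modified_family[OF Z(2) ind' _ _ that])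
    show "M j \<in> \<I> \<or> (\<exists>s\<in>C. \<exists>t\<in>C. s \<noteq> t \<and> M j = D s \<inter> D t)" for j
      using set_ideal_empty[OF Z(2)] by (simp add: M_def)
    show "c j - M j = B j - M j" for j
      by (auto simp: M_def c_def)
  qed
  have avoid: "\<exists>j\<in>C - F. c j \<inter> W = {}" if F: "finite F" and W: "?ok W" for W F
  proof -
    have WZ: "W \<subseteq> Z"
      using W DZ set_ideal_into[OF Z(2)] by blast
    \<comment> \<open>The number component makes \<open>f\<close> injective, so \<open>W\<close> is
      avoided at infinitely many coordinates and hence at one outside \<open>F\<close>.\<close>
    have "\<forall>n. \<exists>j\<in>C. k j = (({}, W), n)"
      using surj WZ by blast
    then obtain f where f: "\<And>n. f n \<in> C" "\<And>n. k (f n) = (({}, W), n)"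
      by metis
    have "inj f"
      using f(2) by (metis injI snd_conv)
    then have "infinite (range f)"
      by (rule range_inj_infinite)
    then obtain n where "f n \<notin> F"
      using F by (metis finite_subset image_subsetI)
    moreover have "c (f n) \<inter> W = {}"
      using W f(2)[of n] by (auto simp: c_def U_def V_def)
    ultimately show ?thesis
      using f(1) by blast
  qed
  have separate: "\<exists>j\<in>C. x \<in> c j \<and> y \<notin> c j" if xy: "x \<in> Z" "y \<in> Z" "x \<noteq> y" for x y
  proof -
    obtain j where j: "j \<in> C" "k j = (({x}, {y}), 0)"
      using surj[of "{x}" "{y}" 0] xy by blast
    have "|{x} \<union> {y}| <o \<kappa>"
      using \<kappa> by (intro Cfinite_ordLess_Cinfinite) (auto simp: cfinite_def Field_card_of card_of_card_order_on)
    then have "{x} \<union> {y} \<in> \<I>"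
      using small xy by simp
    then have "x \<in> c j \<and> y \<notin> c j"
      using j xy by (simp add: c_def U_def V_def)
    then show ?thesis
      using j(1) by blast
  qed
  show thesis
    by (rule that[OF Z small ccc injD DZ cells avoid separate])
qed

subsection \<open>Dense subspaces of the Cantor cube\<close>

definition cube_box :: "'i set \<Rightarrow> 'i set \<Rightarrow> 'i set \<Rightarrow> ('i \<Rightarrow> bool) set" where
  "cube_box I P Q = (\<Pi>\<^sub>E i\<in>I. {b. (i \<in> P \<longrightarrow> b) \<and> (i \<in> Q \<longrightarrow> \<not> b)})"

lemma clopen_cube_box:
  assumes "fin_cond (Field \<mu>) P Q"
  shows "openin (cantor_cube \<mu>) (cube_box (Field \<mu>) P Q)" "closedin (cantor_cube \<mu>) (cube_box (Field \<mu>) P Q)"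
proof -
  have "{i \<in> Field \<mu>. {b. (i \<in> P \<longrightarrow> b) \<and> (i \<in> Q \<longrightarrow> \<not> b)} \<noteq> UNIV} \<subseteq> P \<union> Q"
    by auto
  then have "finite {i \<in> Field \<mu>. {b. (i \<in> P \<longrightarrow> b) \<and> (i \<in> Q \<longrightarrow> \<not> b)} \<noteq> UNIV}"
    using assms unfolding fin_cond_def by (meson finite_UnI finite_subset)
  then show "openin (cantor_cube \<mu>) (cube_box (Field \<mu>) P Q)"
    unfolding cantor_cube_def cube_box_def openin_PiE_gen by simp
  show "closedin (cantor_cube \<mu>) (cube_box (Field \<mu>) P Q)"
    unfolding cantor_cube_def cube_box_def closedin_product_topology by simp
qed

lemma cube_box_neighbourhood:
  assumes "openin (cantor_cube \<mu>) U" "f \<in> U"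
  obtains P Q where "fin_cond (Field \<mu>) P Q" "f \<in> cube_box (Field \<mu>) P Q" "cube_box (Field \<mu>) P Q \<subseteq> U"
proof -
  obtain W where W: "finite {i \<in> Field \<mu>. W i \<noteq> UNIV}" "f \<in> Pi\<^sub>E (Field \<mu>) W" "Pi\<^sub>E (Field \<mu>) W \<subseteq> U"
    using assms unfolding cantor_cube_def openin_product_topology_alt by force
  \<comment> \<open>\<open>P\<close> and \<open>Q\<close> freeze \<open>f\<close> at the finitely
    many coordinates restricted by \<open>W\<close>.\<close>
  define P where "P = {i \<in> Field \<mu>. W i \<noteq> UNIV \<and> f i}"
  define Q where "Q = {i \<in> Field \<mu>. W i \<noteq> UNIV \<and> \<not> f i}"
  show thesis
  proof
    show "fin_cond (Field \<mu>) P Q"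
      using W(1) unfolding fin_cond_def P_def Q_def
      by (auto elim!: finite_subset[rotated])
    show "f \<in> cube_box (Field \<mu>) P Q"
      using W(2) unfolding cube_box_def P_def Q_def by (auto simp: PiE_iff)
    have "cube_box (Field \<mu>) P Q \<subseteq> Pi\<^sub>E (Field \<mu>) W"
    proof
      fix g assume g: "g \<in> cube_box (Field \<mu>) P Q"
      have "g i \<in> W i" if "i \<in> Field \<mu>" for i
      proof (cases "W i = UNIV")
        case False
        then have "g i = f i"
          using g that unfolding cube_box_def P_def Q_def by (auto simp: PiE_iff)
        then show ?thesis
          using W(2) that by (auto simp: PiE_iff)
      qed simp
      then show "g \<in> Pi\<^sub>E (Field \<mu>) W"
        using g unfolding cube_box_def by (auto simp: PiE_iff)
    qed
    then show "cube_box (Field \<mu>) P Q \<subseteq> U"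
      using W(3) by blast
  qed
qed

text \<open>A copy of \<open>Z\<close> in the cube: the cells of \<open>c\<close> form a clopen base
  of it, so topological claims about \<open>X\<close> become claims about cells. Separation makes
  \<open>point\<close> injective, so subsets of \<open>Z\<close> and of \<open>X\<close>
  correspond.\<close>

locale cube_subspace =
  fixes Z :: "'z set" and \<mu> :: "'i rel" and c :: "'i \<Rightarrow> 'z set"
  assumes separate: "x \<in> Z \<Longrightarrow> y \<in> Z \<Longrightarrow> x \<noteq> y \<Longrightarrow> \<exists>j\<in>Field \<mu>. x \<in> c j \<and> y \<notin> c j"
begin

definition point :: "'z \<Rightarrow> 'i \<Rightarrow> bool" where
  "point z = (\<lambda>i\<in>Field \<mu>. z \<in> c i)"

definition X :: "('i \<Rightarrow> bool) topology" where
  "X = subtopology (cantor_cube \<mu>) (point ` Z)"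

lemma inj_on_point: "inj_on point Z"
proof (rule inj_onI, rule ccontr)
  fix x y assume xy: "x \<in> Z" "y \<in> Z" "point x = point y" "x \<noteq> y"
  then obtain j where "j \<in> Field \<mu>" "x \<in> c j" "y \<notin> c j"
    using separate by blast
  then have "point x j" "\<not> point y j"
    by (simp_all add: point_def)
  then show False
    using xy(3) by simp
qed

lemma point_in_topspace: "point ` Z \<subseteq> topspace (cantor_cube \<mu>)"
  by (auto simp: cantor_cube_def point_def)

lemma topspace_X: "topspace X = point ` Z"
  using point_in_topspace by (auto simp: X_def)

lemma cube_box_Int_points:
  assumes "fin_cond (Field \<mu>) P Q"
  shows "cube_box (Field \<mu>) P Q \<inter> point ` Z = point ` cell Z c P Q"
proof -
  have "point z \<in> cube_box (Field \<mu>) P Q \<longleftrightarrow> z \<in> cell Z c P Q" if "z \<in> Z" for z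
    using that assms by (auto simp: cube_box_def cell_def point_def fin_cond_def PiE_iff subset_iff)
  then show ?thesis
    using cell_subset[of Z c P Q] by auto
qed

lemma clopen_cell:
  assumes "fin_cond (Field \<mu>) P Q"
  shows "openin X (point ` cell Z c P Q)" "closedin X (point ` cell Z c P Q)"
  unfolding X_def cube_box_Int_points[OF assms, symmetric]
  using clopen_cube_box[OF assms] by (auto simp: openin_subtopology closedin_subtopology)

lemma cell_neighbourhood:
  assumes "openin X U" "z \<in> Z" "point z \<in> U"
  obtains P Q where "fin_cond (Field \<mu>) P Q" "z \<in> cell Z c P Q" "point ` cell Z c P Q \<subseteq> U"
proof -
  obtain W where W: "openin (cantor_cube \<mu>) W" "U = W \<inter> point ` Z"
    using assms(1) unfolding X_def openin_subtopology by blast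
  then obtain P Q where PQ: "fin_cond (Field \<mu>) P Q" "point z \<in> cube_box (Field \<mu>) P Q"
    "cube_box (Field \<mu>) P Q \<subseteq> W"
    using cube_box_neighbourhood assms(3) by (metis IntD1)
  have "z \<in> cell Z c P Q"
    using PQ(1,2) assms(2) by (auto simp: cube_box_def cell_def point_def fin_cond_def PiE_iff subset_iff)
  moreover have "point ` cell Z c P Q \<subseteq> U"
    using PQ(3) W(2) cube_box_Int_points[OF PQ(1)] by blast
  ultimately show thesis
    using that PQ(1) by blast
qed

lemma nonempty_open_contains_cell:
  assumes "openin X U" "U \<noteq> {}"
  obtains P Q where "fin_cond (Field \<mu>) P Q" "point ` cell Z c P Q \<subseteq> U"
proof -
  have "\<exists>z\<in>Z. point z \<in> U"
    using assms(2) openin_subset[OF assms(1)] unfolding topspace_X by blast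
  then show thesis
    using cell_neighbourhood[OF assms(1)] that by metis
qed

lemma zero_dimensional: "zero_dimensional_space X"
  unfolding zero_dimensional_space_def
proof (rule exI[of _ "{B. openin X B \<and> closedin X B}"], intro conjI allI impI)
  fix U assume U: "openin X U"
  have "\<exists>B. openin X B \<and> closedin X B \<and> p \<in> B \<and> B \<subseteq> U" if p: "p \<in> U" for p
  proof -
    obtain z where z: "z \<in> Z" "p = point z"
      using p openin_subset[OF U] by (auto simp: topspace_X)
    obtain P Q where PQ: "fin_cond (Field \<mu>) P Q" "z \<in> cell Z c P Q" "point ` cell Z c P Q \<subseteq> U"
      using cell_neighbourhood[OF U z(1)] p z(2) by blast
    then show ?thesis
      using clopen_cell[OF PQ(1)] z(2) by blast
  qed
  then have "U = \<Union>{B. openin X B \<and> closedin X B \<and> B \<subseteq> U}"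
    by blast
  then show "\<exists>\<U>\<subseteq>{B. openin X B \<and> closedin X B}. U = \<Union>\<U>"
    by (intro exI[of _ "{B. openin X B \<and> closedin X B \<and> B \<subseteq> U}"]) blast
qed blast

lemma Hausdorff: "Hausdorff_space X"
  unfolding X_def cantor_cube_def
  by (intro Hausdorff_space_subtopology) (simp add: Hausdorff_space_product_topology)

lemma dense_set_image:
  assumes "E \<subseteq> Z" and meet: "\<And>P Q. fin_cond (Field \<mu>) P Q \<Longrightarrow> cell Z c P Q \<inter> E \<noteq> {}"
  shows "dense_set X (point ` E)"
proof -
  have "point ` E \<inter> T \<noteq> {}" if T: "openin X T" "T \<noteq> {}" for T
  proof -
    obtain P Q where PQ: "fin_cond (Field \<mu>) P Q" "point ` cell Z c P Q \<subseteq> T"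
      using nonempty_open_contains_cell T by metis
    then show ?thesis
      using meet[OF PQ(1)] by blast
  qed
  then have "X closure_of (point ` E) = topspace X"
    by (auto simp: dense_intersects_open)
  then show ?thesis
    using assms(1) by (auto simp: dense_set_def topspace_X)
qed

text \<open>If the closure of the image of \<open>M\<close> contained a cell, some
  \<open>c j\<close> missing \<open>M\<close> with \<open>j\<close> outside the condition would
  refine it to a nonempty cell, open, inside that closure and yet disjoint from
  \<open>M\<close>.\<close>

lemma nowhere_dense_image:
  assumes "M \<subseteq> Z" and ne: "\<And>P Q. fin_cond (Field \<mu>) P Q \<Longrightarrow> cell Z c P Q \<noteq> {}"
    and avoid: "\<And>F. finite F \<Longrightarrow> \<exists>j\<in>Field \<mu> - F. c j \<inter> M = {}"
  shows "nowhere_dense_set X (point ` M)"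
proof -
  have False if p: "p \<in> X interior_of (X closure_of (point ` M))" for p
  proof -
    obtain T where T: "openin X T" "T \<subseteq> X closure_of (point ` M)" "p \<in> T"
      using p by (auto simp: interior_of_def)
    then obtain P Q where PQ: "fin_cond (Field \<mu>) P Q" "point ` cell Z c P Q \<subseteq> T"
      using nonempty_open_contains_cell by (metis empty_iff)
    then have "finite (P \<union> Q)"
      by (simp add: fin_cond_def)
    then obtain j where j: "j \<in> Field \<mu>" "j \<notin> P \<union> Q" "c j \<inter> M = {}"
      using avoid by blast
    have j1: "fin_cond (Field \<mu>) {j} {}"
      using j by (simp add: fin_cond_def)
    have "fin_cond (Field \<mu>) (insert j P) Q"
      using PQ(1) j by (simp add: fin_cond_def)
    then obtain w where w: "w \<in> cell Z c (insert j P) Q"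
      using ne by blast
    then have "point w \<in> X closure_of (point ` M)"
      using PQ(2) T(2) by (auto simp: cell_def)
    moreover have "point w \<in> point ` cell Z c {j} {}"
      using w by (auto simp: cell_def)
    ultimately obtain m where m: "m \<in> M" "point m \<in> point ` cell Z c {j} {}"
      using clopen_cell(1)[OF j1] unfolding in_closure_of by blast
    then have "m \<in> cell Z c {j} {}"
      using inj_on_point assms(1) by (auto simp: inj_on_def cell_def subset_iff)
    then show False
      using m(1) j(3) by (auto simp: cell_def)
  qed
  then show ?thesis
    using assms(1) by (auto simp: nowhere_dense_set_def topspace_X)
qed

text \<open>The closure of a dense set has the whole space as interior. In the empty space the empty
  set is both dense and nowhere dense, hence \<open>Z \<noteq> {}\<close>.\<close>

lemma nowhere_dense_not_dense:
  assumes "nowhere_dense_set X A" "Z \<noteq> {}"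
  shows "\<not> dense_set X A"
  using assms interior_of_topspace[of X]
  by (auto simp: nowhere_dense_set_def dense_set_def topspace_X)

end

section \<open>Counting dense sets and the resolvability of the subspace\<close>

text \<open>Passing to a subfamily keeps both requirements, and \<open>Field \<nu>\<close> supplies
  a set of the wanted size. This leads from \<open>2^\<kappa>\<close> dense sets to
  extraresolvability.\<close>

lemma almost_resolvable_mono:
  assumes "almost_resolvable X \<mu>" "\<nu> \<le>o \<mu>" "Card_order \<nu>"
  shows "almost_resolvable X \<nu>"
proof -
  obtain \<D> where \<D>: "|\<D>| =o \<mu>" "\<And>D. D \<in> \<D> \<Longrightarrow> dense_set X D"
    "pairwise (\<lambda>D E. nowhere_dense_set X (D \<inter> E)) \<D>"
    using assms(1) unfolding almost_resolvable_def by blast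
  have \<nu>: "|Field \<nu>| =o \<nu>"
    using assms(3) by (rule card_of_Field_ordIso)
  then have "|Field \<nu>| \<le>o |\<D>|"
    using \<D>(1) assms(2) ordIso_ordLeq_trans ordIso_symmetric ordLeq_ordIso_trans by blast
  then obtain f where f: "inj_on f (Field \<nu>)" "f ` Field \<nu> \<subseteq> \<D>"
    using card_of_ordLeq by metis
  have "|f ` Field \<nu>| =o |Field \<nu>|"
    using f(1) card_of_ordIsoI inj_on_imp_bij_betw ordIso_symmetric by blast
  then have "|f ` Field \<nu>| =o \<nu>"
    using \<nu> ordIso_transitive by blast
  moreover have "\<forall>D\<in>f ` Field \<nu>. dense_set X D"
    using f(2) \<D>(2) by blast
  moreover have "pairwise (\<lambda>D E. nowhere_dense_set X (D \<inter> E)) (f ` Field \<nu>)"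
    using \<D>(3) f(2) by (rule pairwise_subset)
  ultimately show ?thesis
    unfolding almost_resolvable_def by blast
qed

lemma uncountable_omega1:
  assumes "|A| =o omega1"
  shows "\<not> countable A"
proof
  assume "countable A"
  then have "|A| \<le>o |UNIV :: nat set|"
    unfolding countable_def card_of_ordLeq[symmetric] by blast
  then have "|A| \<le>o natLeq"
    using card_of_nat ordLeq_ordIso_trans by blast
  moreover have "natLeq <o |A|"
    using assms cardSuc_greater[OF natLeq_Card_order] ordIso_symmetric ordLess_ordIso_trans
    unfolding omega1_def by blast
  ultimately show False
    using not_ordLess_ordLeq by blast
qed

theorem theorem3:
  fixes \<kappa> :: "'k rel"
  assumes "Cinfinite \<kappa>"
  shows "\<exists>S. kappa_dense \<kappa> (cantor_cube (ctwo ^c \<kappa>)) S \<and>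
           (let X = subtopology (cantor_cube (ctwo ^c \<kappa>)) S in
              zero_dimensional_space X \<and> Hausdorff_space X \<and>
              |topspace X| =o \<kappa> \<and> dispersion_character X =o \<kappa> \<and>
              almost_resolvable X (ctwo ^c \<kappa>) \<and> extraresolvable X \<and>
              \<not> resolvable X omega1)"
proof -
  let ?\<mu> = "ctwo ^c \<kappa>"
  let ?C = "Field ?\<mu>"
  \<comment> \<open>The coordinates of the cube are the functions from \<open>Field \<kappa>\<close>
    to the booleans; this same set indexes both \<open>D\<close> and \<open>c\<close>.\<close>
  have "?C = Func (Field \<kappa>) (UNIV :: bool set)"
    by (simp add: cexp_def ctwo_def Field_card_of)
  then have PowC: "|?C| =o |Pow (Field \<kappa>)|"
    using card_of_Pow_Func ordIso_symmetric by metis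
  have C\<mu>: "|?C| =o ?\<mu>"
    by (intro card_of_Field_ordIso Card_order_cexp)
  obtain Z :: "('k list \<times> 'k list list) set" and \<I> and D c :: "('k \<Rightarrow> bool) \<Rightarrow> ('k list \<times> 'k list list) set"
    where Z: "|Z| =o \<kappa>" and ideal: "set_ideal Z \<I>"
      and small: "\<And>A. A \<subseteq> Z \<Longrightarrow> |A| <o \<kappa> \<Longrightarrow> A \<in> \<I>"
      and ccc: "\<And>\<E>. (\<And>A. A \<in> \<E> \<Longrightarrow> A \<subseteq> Z \<and> A \<notin> \<I>) \<Longrightarrow> pairwise disjnt \<E> \<Longrightarrow> countable \<E>"
      and injD: "inj_on D ?C" and DZ: "\<And>s. D s \<subseteq> Z"
      and cells: "\<And>s P Q. s \<in> ?C \<Longrightarrow> fin_cond ?C P Q \<Longrightarrow> cell Z c P Q \<inter> D s \<notin> \<I>"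
      and avoid: "\<And>M F. finite F \<Longrightarrow> M \<in> \<I> \<or> (\<exists>s\<in>?C. \<exists>t\<in>?C. s \<noteq> t \<and> M = D s \<inter> D t) \<Longrightarrow>
        \<exists>j\<in>?C - F. c j \<inter> M = {}"
      and separate: "\<And>x y. x \<in> Z \<Longrightarrow> y \<in> Z \<Longrightarrow> x \<noteq> y \<Longrightarrow> \<exists>j\<in>?C. x \<in> c j \<and> y \<notin> c j"
    by (fact modified_family_exists[OF assms PowC])
  interpret cube_subspace Z ?\<mu> c
    using separate by unfold_locales
  have Ine: "A \<noteq> {}" if "A \<notin> \<I>" for A
    using that set_ideal_empty[OF ideal] by auto
  obtain s0 where s0: "s0 \<in> ?C"
    \<comment> \<open>Avoiding the empty set produces a coordinate \<open>s0\<close>; each cell then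
      contains its part in \<open>D s0\<close>, which is outside the ideal.\<close>
    using avoid[of "{}" "{}"] set_ideal_empty[OF ideal] by blast
  have cell_pos: "cell Z c P Q \<notin> \<I>" if "fin_cond ?C P Q" for P Q
    using cells[OF s0 that] set_ideal_subset[OF ideal] by blast
  have cell_ne: "cell Z c P Q \<noteq> {}" if "fin_cond ?C P Q" for P Q
    using cell_pos[OF that] by (rule Ine)
  have "fin_cond ?C {} {}"
    by (simp add: fin_cond_def)
  then have Zne: "Z \<noteq> {}"
    using cell_ne[of "{}" "{}"] by (auto simp: cell_def)
  have card_image: "|point ` A| =o |A|" if "A \<subseteq> Z" for A
    using that inj_on_point card_of_ordIsoI inj_on_imp_bij_betw inj_on_subset ordIso_symmetric by metis
  have Xcard: "|topspace X| =o \<kappa>"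
    unfolding topspace_X using card_image[OF subset_refl] Z ordIso_transitive by blast

  \<comment> \<open>This bound gives both \<kappa>-density in the cube and the lower bound for the
    dispersion character.\<close>
  have large: "\<kappa> \<le>o |point ` cell Z c P Q|" if "fin_cond ?C P Q" for P Q
  proof -
    have "\<not> |cell Z c P Q| <o \<kappa>"
      using small[OF cell_subset] cell_pos[OF that] by blast
    then have "\<kappa> \<le>o |cell Z c P Q|"
      using assms card_of_Well_order not_ordLess_iff_ordLeq card_order_on_well_order_on by blast
    then show ?thesis
      using card_image[OF cell_subset] ordIso_symmetric ordLeq_ordIso_trans by blast
  qed
  have \<kappa>_dense: "kappa_dense \<kappa> (cantor_cube ?\<mu>) (point ` Z)"
    unfolding kappa_dense_def
  proof (intro conjI allI impI point_in_topspace)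
    fix U assume "openin (cantor_cube ?\<mu>) U \<and> U \<noteq> {}"
    then obtain P Q where PQ: "fin_cond ?C P Q" "cube_box ?C P Q \<subseteq> U"
      using cube_box_neighbourhood by (metis equals0I)
    then have "point ` cell Z c P Q \<subseteq> point ` Z \<inter> U"
      using cube_box_Int_points[OF PQ(1)] by blast
    then show "\<kappa> \<le>o |point ` Z \<inter> U|"
      by (rule ordLeq_transitive[OF large[OF PQ(1)] card_of_mono1])
  qed

  have Xdisp: "dispersion_character X =o \<kappa>"
  proof -
    have "topspace X \<noteq> {}"
      using Zne by (simp add: topspace_X)
    then obtain G where G: "openin X G" "G \<noteq> {}" "dispersion_character X = |G|"
      by (rule dispersion_character_is_min) blast
    obtain P Q where PQ: "fin_cond ?C P Q" "point ` cell Z c P Q \<subseteq> G"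
      using nonempty_open_contains_cell G(1,2) by metis
    have "\<kappa> \<le>o |G|"
      using large[OF PQ(1)] card_of_mono1[OF PQ(2)] by (rule ordLeq_transitive)
    moreover have "|G| \<le>o \<kappa>"
      using card_of_mono1[OF openin_subset[OF G(1)]] Xcard by (rule ordLeq_ordIso_trans)
    ultimately show ?thesis
      unfolding G(3) using ordIso_iff_ordLeq by blast
  qed

  have almost: "almost_resolvable X ?\<mu>"
    unfolding almost_resolvable_def
  proof (intro exI[of _ "(\<lambda>s. point ` D s) ` ?C"] conjI ballI)
    \<comment> \<open>Dense sets are counted as members of a set, so different indices must give
      different images.\<close>
    have inj: "inj_on (\<lambda>s. point ` D s) ?C"
      using injD DZ inj_on_image_eq_iff[OF inj_on_point] by (auto simp: inj_on_def)
    then have "|(\<lambda>s. point ` D s) ` ?C| =o |?C|"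
      using card_of_ordIsoI inj_on_imp_bij_betw ordIso_symmetric by blast
    then show "|(\<lambda>s. point ` D s) ` ?C| =o ?\<mu>"
      using C\<mu> ordIso_transitive by blast
    show "dense_set X E" if "E \<in> (\<lambda>s. point ` D s) ` ?C" for E
      using that dense_set_image[OF DZ Ine[OF cells]] by blast
    show "pairwise (\<lambda>D E. nowhere_dense_set X (D \<inter> E)) ((\<lambda>s. point ` D s) ` ?C)"
    proof (rule pairwiseI)
      fix E E' assume "E \<in> (\<lambda>s. point ` D s) ` ?C" "E' \<in> (\<lambda>s. point ` D s) ` ?C" "E \<noteq> E'"
      then obtain s t where st: "s \<in> ?C" "t \<in> ?C" "s \<noteq> t" and E: "E = point ` D s" "E' = point ` D t"
        by blast
      have "E \<inter> E' = point ` (D s \<inter> D t)"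
        unfolding E using inj_on_image_Int[OF inj_on_point DZ DZ] by simp
      moreover have "nowhere_dense_set X (point ` (D s \<inter> D t))"
        using DZ[of s] cell_ne st by (intro nowhere_dense_image avoid) auto
      ultimately show "nowhere_dense_set X (E \<inter> E')"
        by simp
    qed
  qed

  have extra: "extraresolvable X"
    unfolding extraresolvable_def
  proof (rule almost_resolvable_mono[OF almost])
    have card: "Card_order (dispersion_character X)"
      by (simp add: dispersion_character_def card_of_Card_order)
    \<comment> \<open>Cantor's theorem gives \<kappa> below \<open>2^\<kappa>\<close>, so the
      successor of \<kappa> is at most \<open>2^\<kappa>\<close>.\<close>
    have "dispersion_character X =o |Field \<kappa>|"
      using Xdisp assms card_of_Field_ordIso ordIso_symmetric ordIso_transitive by blast
    moreover have "|Pow (Field \<kappa>)| =o ?\<mu>"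
      using PowC C\<mu> ordIso_symmetric ordIso_transitive by blast
    ultimately have "dispersion_character X <o ?\<mu>"
      using card_of_Pow ordIso_ordLess_trans ordLess_ordIso_trans by blast
    then show "cardSuc (dispersion_character X) \<le>o ?\<mu>"
      by (intro cardSuc_least card Card_order_cexp)
    show "Card_order (cardSuc (dispersion_character X))"
      using card by (rule cardSuc_Card_order)
  qed

  have "\<not> resolvable X omega1"
  proof
    assume "resolvable X omega1"
    then obtain \<D> where \<D>: "|\<D>| =o omega1" "\<And>E. E \<in> \<D> \<Longrightarrow> dense_set X E" "pairwise disjnt \<D>"
      unfolding resolvable_def by blast
    \<comment> \<open>Dense sets are pulled back to \<open>Z\<close>. A preimage in the ideal would
      be exceptional, so its image would be nowhere dense; hence all preimages lie outside the ideal
      and \<open>ccc\<close> applies.\<close>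
    let ?p = "\<lambda>E. {z \<in> Z. point z \<in> E}"
    have img: "point ` ?p E = E" if "E \<in> \<D>" for E
      using \<D>(2)[OF that] by (auto simp: dense_set_def topspace_X)
    have "countable (?p ` \<D>)"
    proof (rule ccc)
      fix A assume "A \<in> ?p ` \<D>"
      then obtain E where E: "E \<in> \<D>" "A = ?p E"
        by blast
      have "A \<notin> \<I>"
      proof
        assume "A \<in> \<I>"
        then have "nowhere_dense_set X (point ` A)"
          using set_ideal_into[OF ideal] cell_ne avoid by (intro nowhere_dense_image) auto
        then show False
          using nowhere_dense_not_dense Zne \<D>(2)[OF E(1)] img[OF E(1)] E(2) by metis
      qed
      then show "A \<subseteq> Z \<and> A \<notin> \<I>"
        using E(2) by blast
    next
      show "pairwise disjnt (?p ` \<D>)"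
        using \<D>(3) unfolding pairwise_def disjnt_def by blast
    qed
    moreover have "inj_on ?p \<D>"
      using img by (metis (no_types, lifting) inj_onI)
    ultimately have "countable \<D>"
      by (rule countable_image_inj_on)
    then show False
      using uncountable_omega1[OF \<D>(1)] by blast
  qed
  with \<kappa>_dense zero_dimensional Hausdorff Xcard Xdisp almost extra show ?thesis
    unfolding X_def Let_def by blast
qed

end
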